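(* If $G$ is a $\overline{P_3}$-free graph with $k$ universal vertices, then $ch_B(G) = \chi_B(G) = \chi_S(G) = ch_S(G) = \max\{2,k\}$.
   Context: All graphs are finite and simple; $\overline{P_3}$ is the complement of the path on three vertices (an edge plus an isolated vertex), and $\overline{P_3}$-free means no induced $\overline{P_3}$. A universal vertex is adjacent to all other vertices. A biclique of $G$ is a set $W\subseteq V(G)$ with $G[W]$ complete bipartite $K_{n,m}$ ($n,m\ge1$); a star is a biclique inducing $K_{1,m}$; maximal means not properly contained in another biclique (resp. star). A $k$-coloring is a map $\rho:V(G)\to\{1,\dots,k\}$; a set $W$ is monochromatic if $|\rho(W)|=1$. A star (biclique) coloring has no monochromatic maximal star (biclique). For a list assignment $L$ ($L(v)\subseteq\mathbb N$, a $k$-list assignment if $|L(v)|=k$), an $L$-coloring satisfies $\rho(v)\in L(v)$; $G$ is star (biclique) $k$-choosable if for every $k$-list assignment $L$ there is an $L$-coloring with no monochromatic maximal star (biclique). $\chi_S,\chi_B$ are the minimum $k$ admitting a star, resp. biclique, $k$-coloring; $ch_S, ch_B$ the minimum $k$ for which $G$ is star, resp. biclique, $k$-choosable.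
   Formalization: The formal theorem additionally assumes that G has at least one edge; for edgeless graphs (e.g. a single vertex) there is no star or biclique, so all four parameters are at most 1 and the stated equality with max{2,k} fails. *)

theory Defs
  imports "Graph_Theory.Graph_Theory"
begin

text \<open>
  A finite simple graph is a \<open>graph\<close> in the sense of the Graph_Theory library: a finite symmetric
  digraph without loops and parallel arcs, each edge being a pair of opposite arcs.
\<close>

definition path3 :: "nat pair_pre_digraph" where
  "path3 = \<lparr> pverts = {0, 1, 2}, parcs = {(0, 1), (1, 0), (1, 2), (2, 1)} \<rparr>"

definition complement :: "'a pair_pre_digraph \<Rightarrow> 'a pair_pre_digraph" where
  "complement H = \<lparr> pverts = pverts H,
     parcs = {(u, v). u \<in> pverts H \<and> v \<in> pverts H \<and> u \<noteq> v \<and> (u, v) \<notin> parcs H} \<rparr>"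

definition induced_free :: "('c, 'd) pre_digraph \<Rightarrow> ('a, 'b) pre_digraph \<Rightarrow> bool" where
  "induced_free H G \<longleftrightarrow> \<not> (\<exists>W \<subseteq> verts G. digraph_iso (G \<restriction> W) H)"

definition co_P3_free :: "('a, 'b) pre_digraph \<Rightarrow> bool" where
  "co_P3_free G \<longleftrightarrow> induced_free (with_proj (complement path3)) G"

definition universal_vertex :: "('a, 'b) pre_digraph \<Rightarrow> 'a \<Rightarrow> bool" where
  "universal_vertex G v \<longleftrightarrow> v \<in> verts G \<and> (\<forall>u \<in> verts G - {v}. v \<rightarrow>\<^bsub>G\<^esub> u)"

definition biclique :: "('a, 'b) pre_digraph \<Rightarrow> 'a set \<Rightarrow> bool" where
  "biclique G W \<longleftrightarrow> W \<subseteq> verts G \<and>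
     (\<exists>n m. n \<ge> 1 \<and> m \<ge> 1 \<and> complete_bipartite_digraph n m (G \<restriction> W))"

definition star :: "('a, 'b) pre_digraph \<Rightarrow> 'a set \<Rightarrow> bool" where
  "star G W \<longleftrightarrow> W \<subseteq> verts G \<and> (\<exists>m \<ge> 1. complete_bipartite_digraph 1 m (G \<restriction> W))"

text \<open>A maximal star is maximal among stars only; it may be properly contained in a biclique.\<close>

definition maximal_biclique :: "('a, 'b) pre_digraph \<Rightarrow> 'a set \<Rightarrow> bool" where
  "maximal_biclique G W \<longleftrightarrow> biclique G W \<and> \<not> (\<exists>W'. biclique G W' \<and> W \<subset> W')"

definition maximal_star :: "('a, 'b) pre_digraph \<Rightarrow> 'a set \<Rightarrow> bool" where
  "maximal_star G W \<longleftrightarrow> star G W \<and> \<not> (\<exists>W'. star G W' \<and> W \<subset> W')"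

definition monochromatic :: "('a \<Rightarrow> nat) \<Rightarrow> 'a set \<Rightarrow> bool" where
  "monochromatic \<rho> W \<longleftrightarrow> card (\<rho> ` W) = 1"

definition biclique_coloring :: "('a, 'b) pre_digraph \<Rightarrow> ('a \<Rightarrow> nat) \<Rightarrow> bool" where
  "biclique_coloring G \<rho> \<longleftrightarrow> \<not> (\<exists>W. maximal_biclique G W \<and> monochromatic \<rho> W)"

definition star_coloring :: "('a, 'b) pre_digraph \<Rightarrow> ('a \<Rightarrow> nat) \<Rightarrow> bool" where
  "star_coloring G \<rho> \<longleftrightarrow> \<not> (\<exists>W. maximal_star G W \<and> monochromatic \<rho> W)"

definition k_coloring :: "nat \<Rightarrow> ('a, 'b) pre_digraph \<Rightarrow> ('a \<Rightarrow> nat) \<Rightarrow> bool" where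
  "k_coloring k G \<rho> \<longleftrightarrow> (\<forall>v \<in> verts G. \<rho> v \<in> {1..k})"

definition list_assignment :: "nat \<Rightarrow> ('a, 'b) pre_digraph \<Rightarrow> ('a \<Rightarrow> nat set) \<Rightarrow> bool" where
  "list_assignment k G L \<longleftrightarrow> (\<forall>v \<in> verts G. finite (L v) \<and> card (L v) = k)"

definition list_coloring :: "('a, 'b) pre_digraph \<Rightarrow> ('a \<Rightarrow> nat set) \<Rightarrow> ('a \<Rightarrow> nat) \<Rightarrow> bool" where
  "list_coloring G L \<rho> \<longleftrightarrow> (\<forall>v \<in> verts G. \<rho> v \<in> L v)"

definition biclique_choosable :: "nat \<Rightarrow> ('a, 'b) pre_digraph \<Rightarrow> bool" where
  "biclique_choosable k G \<longleftrightarrow>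
     (\<forall>L. list_assignment k G L \<longrightarrow> (\<exists>\<rho>. list_coloring G L \<rho> \<and> biclique_coloring G \<rho>))"

definition star_choosable :: "nat \<Rightarrow> ('a, 'b) pre_digraph \<Rightarrow> bool" where
  "star_choosable k G \<longleftrightarrow>
     (\<forall>L. list_assignment k G L \<longrightarrow> (\<exists>\<rho>. list_coloring G L \<rho> \<and> star_coloring G \<rho>))"

definition chi_B :: "('a, 'b) pre_digraph \<Rightarrow> nat" where
  "chi_B G = (LEAST k. \<exists>\<rho>. k_coloring k G \<rho> \<and> biclique_coloring G \<rho>)"

definition chi_S :: "('a, 'b) pre_digraph \<Rightarrow> nat" where
  "chi_S G = (LEAST k. \<exists>\<rho>. k_coloring k G \<rho> \<and> star_coloring G \<rho>)"

definition ch_B :: "('a, 'b) pre_digraph \<Rightarrow> nat" where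
  "ch_B G = (LEAST k. biclique_choosable k G)"

definition ch_S :: "('a, 'b) pre_digraph \<Rightarrow> nat" where
  "ch_S G = (LEAST k. star_choosable k G)"

text \<open>
  An edgeless graph contains no biclique at all, so one color suffices, although it is
  co-\<open>P\<^sub>3\<close>-free. An equality with \<open>max 2 k\<close> therefore needs at least one edge.
\<close>

lemma edgeless_chi_le_1:
  assumes "arcs G = {}"
  shows "chi_B G \<le> 1" and "chi_S G \<le> 1"
proof -
  have "\<not> complete_bipartite_digraph n m (G \<restriction> W)" if "n \<ge> 1" "m \<ge> 1" for n m W
    using assms that by (fastforce simp: complete_bipartite_digraph_def arcs_ends_def)
  then have "\<not> biclique G W" "\<not> star G W" for W
    by (auto simp: biclique_def star_def)
  then have "k_coloring 1 G (\<lambda>_. 1) \<and> biclique_coloring G (\<lambda>_. 1)"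
    and "k_coloring 1 G (\<lambda>_. 1) \<and> star_coloring G (\<lambda>_. 1)"
    by (auto simp: k_coloring_def biclique_coloring_def star_coloring_def
        maximal_biclique_def maximal_star_def)
  then show "chi_B G \<le> 1" "chi_S G \<le> 1"
    unfolding chi_B_def chi_S_def by (blast intro: Least_le)+
qed

end

theory Submission
  imports Defs
begin

text \<open>
  Non-adjacency is an equivalence relation on the vertices of a co-\<open>P\<^sub>3\<close>-free graph, so the graph is
  complete multipartite and its universal vertices are the singleton parts. Every maximal star and
  every maximal biclique either contains a whole part with at least two vertices or consists of two
  universal vertices. Hence it suffices to give the universal vertices distinct colors and to use
  two colors on every other part, which is possible for lists of size \<open>max 2 k\<close>. Conversely, any
  two universal vertices form a maximal star and a maximal biclique, so they need distinct colors.
\<close>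

section \<open>Greedy selection and maximal sets\<close>

text \<open>Greedy choice: by the time \<open>x\<close> gets its color, at most
  \<open>card A\<close> colors are in use, fewer than the size of its list. It later gives the
  universal vertices distinct colors from their lists.\<close>

lemma inj_on_choice_of_card_le:
  assumes "finite A" and "\<And>a. a \<in> A \<Longrightarrow> finite (L a) \<and> card A \<le> card (L a)"
  shows "\<exists>f. inj_on f A \<and> (\<forall>a \<in> A. f a \<in> L a)"
  using assms
proof (induction A rule: finite_induct)
  case empty
  then show ?case by simp
next
  case (insert x A)
  then obtain f where f: "inj_on f A" "\<forall>a \<in> A. f a \<in> L a"
    by (metis card_insert_le insertCI le_trans)
  have "card (f ` A) < card (L x)"
    using insert.prems[of x] insert.hyps card_image_le[of A f] by simp
  then obtain c where c: "c \<in> L x" "c \<notin> f ` A"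
    using insert.hyps by (metis card_mono finite_imageI not_less subsetI)
  have "inj_on (f(x := c)) (insert x A)" "\<forall>a \<in> insert x A. (f(x := c)) a \<in> L a"
    using f c insert.hyps by (auto simp: inj_on_def)
  then show ?case by blast
qed

lemma ex_maximal_of_finite:
  assumes "finite {W. P W}" "P A"
  shows "\<exists>W. P W \<and> \<not> (\<exists>W'. P W' \<and> W \<subset> W')"
proof -
  obtain W where "P W" "\<And>W'. P W' \<Longrightarrow> W \<subseteq> W' \<Longrightarrow> W = W'"
    using finite_has_maximal2[OF assms(1), of A] assms(2) by auto
  then show ?thesis by (intro exI[of _ W]) auto
qed

lemma arcs_ends_induce_subgraph:
  "arcs_ends (G \<restriction> W) = arcs_ends G \<inter> W \<times> W"
  by (auto simp: arcs_ends_conv)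

text \<open>In a loopless graph this set contains \<open>v\<close> itself. In a co-P3-free graph it
  is the part of \<open>v\<close> in the complete multipartite structure, and it is
  \<open>{v}\<close> exactly when \<open>v\<close> is universal.\<close>

definition nonneighbors :: "('a, 'b) pre_digraph \<Rightarrow> 'a \<Rightarrow> 'a set" where
  "nonneighbors G v = {x \<in> verts G. \<not> v \<rightarrow>\<^bsub>G\<^esub> x}"

context graph
begin

lemma adj_sym: "u \<rightarrow> v \<Longrightarrow> v \<rightarrow> u"
  using arcs_ends_symmetric[OF sym_arcs] .

lemma adj_irrefl: "\<not> u \<rightarrow> u"
  using adj_not_same by blast

section \<open>Bicliques and stars in terms of adjacency\<close>

text \<open>\<open>complete_bipartite_digraph\<close> asks its argument to be a
  \<open>graph\<close>; this settles that conjunct for every induced subgraph.\<close>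

lemma graph_induce_subgraph:
  assumes "W \<subseteq> verts G"
  shows "graph (G \<restriction> W)"
proof -
  interpret W: wf_digraph "G \<restriction> W"
    by (rule wellformed_induce_subgraph)
  show ?thesis
  proof
    show "finite (verts (G \<restriction> W))"
      using finite_subset[OF assms finite_verts] by simp
    show "symmetric (G \<restriction> W)"
      unfolding symmetric_def arcs_ends_induce_subgraph by (auto intro!: symI dest: adj_sym)
    show "e1 = e2" if "e1 \<in> arcs (G \<restriction> W)" "e2 \<in> arcs (G \<restriction> W)"
      "arc_to_ends (G \<restriction> W) e1 = arc_to_ends (G \<restriction> W) e2" for e1 e2
      using that no_multi_arcs[of e1 e2] by (auto simp: arc_to_ends_def)
  qed (use no_loops in auto)
qed

text \<open>By finiteness, side sizes of at least 1 amount to nonempty sides. The equation for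
  \<open>arcs_ends\<close> says both that the sides are completely joined and that each is
  independent.\<close>

lemma biclique_iff:
  "biclique G W \<longleftrightarrow> W \<subseteq> verts G \<and> (\<exists>U V. U \<noteq> {} \<and> V \<noteq> {} \<and> W = U \<union> V \<and> U \<inter> V = {} \<and>
     arcs_ends G \<inter> W \<times> W = U \<times> V \<union> V \<times> U)"
proof (cases "W \<subseteq> verts G")
  case True
  have "card S \<ge> 1 \<longleftrightarrow> S \<noteq> {}" if "S \<subseteq> W" for S
    using finite_subset[OF subset_trans[OF that True] finite_verts]
    by (simp add: Suc_le_eq card_gt_0_iff)
  then show ?thesis
    using True graph_induce_subgraph[OF True]
    unfolding biclique_def complete_bipartite_digraph_def arcs_ends_induce_subgraph
      induce_subgraph_verts
    by (smt (verit) Un_upper1 Un_upper2)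
qed (simp add: biclique_def)

text \<open>The side of size 1 is the center \<open>c\<close>. Absence of loops makes adjacency of
  \<open>c\<close> to all of \<open>V\<close> imply \<open>c \<notin> V\<close>, and symmetry
  supplies the arcs from \<open>V\<close> back to \<open>c\<close>.\<close>

lemma star_iff:
  "star G W \<longleftrightarrow> W \<subseteq> verts G \<and> (\<exists>c V. V \<noteq> {} \<and> W = insert c V \<and> (\<forall>v \<in> V. c \<rightarrow> v) \<and>
     (\<forall>u \<in> V. \<forall>v \<in> V. \<not> u \<rightarrow> v))"
proof (cases "W \<subseteq> verts G")
  case True
  have card: "card S \<ge> 1 \<longleftrightarrow> S \<noteq> {}" if "S \<subseteq> W" for S
    using finite_subset[OF subset_trans[OF that True] finite_verts]
    by (simp add: Suc_le_eq card_gt_0_iff)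
  have star_eq: "star G W \<longleftrightarrow> (\<exists>c V. V \<noteq> {} \<and> W = insert c V \<and> c \<notin> V \<and>
      arcs_ends G \<inter> W \<times> W = {c} \<times> V \<union> V \<times> {c})" (is "_ \<longleftrightarrow> ?R")
  proof
    assume "star G W"
    then obtain m U V where "m \<ge> 1" "W = U \<union> V" "U \<inter> V = {}" "card U = 1" "card V = m"
      "arcs_ends G \<inter> W \<times> W = U \<times> V \<union> V \<times> U"
      unfolding star_def complete_bipartite_digraph_def arcs_ends_induce_subgraph
        induce_subgraph_verts by blast
    moreover from this obtain c where "U = {c}" by (auto simp: card_1_singleton_iff)
    ultimately show ?R using card[of V] by (intro exI[of _ c] exI[of _ V]) auto
  next
    assume ?R
    then obtain c V where cV: "V \<noteq> {}" "W = insert c V" "c \<notin> V"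
      "arcs_ends G \<inter> W \<times> W = {c} \<times> V \<union> V \<times> {c}" by blast
    then have "complete_bipartite_digraph 1 (card V) (G \<restriction> W)"
      using graph_induce_subgraph[OF True]
      unfolding complete_bipartite_digraph_def arcs_ends_induce_subgraph induce_subgraph_verts
      by (intro conjI exI[of _ "{c}"] exI[of _ V]) simp_all
    moreover have "card V \<ge> 1" using card[of V] cV by blast
    ultimately show "star G W" using True unfolding star_def by blast
  qed
  have "c \<notin> V \<and> arcs_ends G \<inter> insert c V \<times> insert c V = {c} \<times> V \<union> V \<times> {c} \<longleftrightarrow>
      (\<forall>v \<in> V. c \<rightarrow> v) \<and> (\<forall>u \<in> V. \<forall>v \<in> V. \<not> u \<rightarrow> v)" (is "?L \<longleftrightarrow> ?R") for c V
  proof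
    show ?R if ?L
      using that by (auto simp: set_eq_iff)
    show ?L if ?R
      using that adj_irrefl[of c] by (auto intro: adj_sym)
  qed
  then have "V \<noteq> {} \<and> W = insert c V \<and> c \<notin> V \<and> arcs_ends G \<inter> W \<times> W = {c} \<times> V \<union> V \<times> {c} \<longleftrightarrow>
      V \<noteq> {} \<and> W = insert c V \<and> (\<forall>v \<in> V. c \<rightarrow> v) \<and> (\<forall>u \<in> V. \<forall>v \<in> V. \<not> u \<rightarrow> v)" for c V
    by (cases "W = insert c V") (simp_all only: simp_thms)
  then show ?thesis unfolding star_eq using True by (simp only: simp_thms)
qed (simp add: star_def)

lemma star_imp_biclique: "star G W \<Longrightarrow> biclique G W"
  unfolding star_def biclique_def by blast

lemma star_edge: "u \<rightarrow> v \<Longrightarrow> star G {u, v}"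
  unfolding star_iff using adj_in_verts[of u v] adj_irrefl by blast

section \<open>Universal pairs and the lower bound\<close>

text \<open>A third vertex would form a triangle with \<open>x\<close> and \<open>y\<close>, and two
  of its corners would share a side of the biclique.\<close>

lemma biclique_universal_pair:
  assumes "biclique G W" "universal_vertex G x" "universal_vertex G y" "x \<noteq> y" "{x, y} \<subseteq> W"
  shows "W = {x, y}"
proof -
  obtain U V where "W \<subseteq> verts G" and UV: "W = U \<union> V" "U \<inter> V = {}"
    "arcs_ends G \<inter> W \<times> W = U \<times> V \<union> V \<times> U"
    using assms(1) unfolding biclique_iff by blast
  have "z \<in> {x, y}" if z: "z \<in> W" for z
  proof (rule ccontr)
    assume "z \<notin> {x, y}"
    then have "x \<rightarrow> y" "x \<rightarrow> z" "y \<rightarrow> z"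
      using z assms(2-5) \<open>W \<subseteq> verts G\<close> unfolding universal_vertex_def by blast+
    then have "{(x, y), (x, z), (y, z)} \<subseteq> U \<times> V \<union> V \<times> U"
      using z assms(5) unfolding UV(3)[symmetric] by blast
    then show False using UV(2) by blast
  qed
  then show ?thesis using assms(5) by blast
qed

lemma maximal_universal_pair:
  assumes "universal_vertex G x" "universal_vertex G y" "x \<noteq> y"
  shows "maximal_star G {x, y}" "maximal_biclique G {x, y}"
proof -
  have "x \<rightarrow> y" using assms unfolding universal_vertex_def by blast
  then have "star G {x, y}" by (rule star_edge)
  then show "maximal_star G {x, y}" "maximal_biclique G {x, y}"
    using biclique_universal_pair[OF _ assms] star_imp_biclique
    unfolding maximal_star_def maximal_biclique_def by blast+
qed

lemma
  assumes "arcs G \<noteq> {}"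
  shows ex_maximal_star: "\<exists>W. maximal_star G W"
    and ex_maximal_biclique: "\<exists>W. maximal_biclique G W"
proof -
  obtain u v where "u \<rightarrow> v"
    using assms by (auto simp: arcs_ends_conv)
  then have W: "star G {u, v}" "biclique G {u, v}"
    using star_edge star_imp_biclique by blast+
  have fin: "finite {W. star G W}" "finite {W. biclique G W}"
    by (rule finite_subset[of _ "Pow (verts G)"]; auto simp: star_def biclique_def)+
  show "\<exists>W. maximal_star G W" "\<exists>W. maximal_biclique G W"
    unfolding maximal_star_def maximal_biclique_def
    using ex_maximal_of_finite[OF fin(1) W(1)] ex_maximal_of_finite[OF fin(2) W(2)] by simp_all
qed

lemma maximal_nonempty:
  "maximal_star G W \<Longrightarrow> W \<noteq> {}" "maximal_biclique G W \<Longrightarrow> W \<noteq> {}"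
  unfolding maximal_star_def maximal_biclique_def star_iff biclique_iff by blast+

lemma finite_universal: "finite {v. universal_vertex G v}"
  by (rule finite_subset[of _ "verts G"]) (auto simp: universal_vertex_def)

text \<open>Two universal vertices form a maximal star and a maximal biclique, so their colors
  differ, which gives the cardinality bound. The bound 2 holds because an edge extends to some
  maximal star or biclique, and that set must see two colors. The disjunctive hypothesis serves both
  kinds of coloring at once.\<close>

lemma max_2_card_universal_le:
  assumes "arcs G \<noteq> {}" "k_coloring c G \<rho>" "star_coloring G \<rho> \<or> biclique_coloring G \<rho>"
  shows "max 2 (card {v. universal_vertex G v}) \<le> c"
proof -
  have "inj_on \<rho> {v. universal_vertex G v}"
    using assms(3) maximal_universal_pair
    unfolding star_coloring_def biclique_coloring_def monochromatic_def inj_on_def by fastforce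
  moreover have "\<rho> ` {v. universal_vertex G v} \<subseteq> {1..c}"
    using assms(2) unfolding k_coloring_def universal_vertex_def by blast
  ultimately have "card {v. universal_vertex G v} \<le> c"
    using card_inj_on_le[of \<rho> "{v. universal_vertex G v}" "{1..c}"] by simp
  moreover obtain W where W: "W \<noteq> {}" "W \<subseteq> verts G" "\<not> monochromatic \<rho> W"
    using assms(3) ex_maximal_star[OF assms(1)] ex_maximal_biclique[OF assms(1)] maximal_nonempty
    unfolding star_coloring_def biclique_coloring_def
    by (metis biclique_def maximal_biclique_def maximal_star_def star_def)
  have "2 \<le> c"
  proof (rule ccontr)
    assume "\<not> 2 \<le> c"
    \<comment> \<open>This covers \<open>c = 0\<close> as well, where the color set is
      empty.\<close>
    then have "\<rho> ` W \<subseteq> {1}"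
      using W(2) assms(2) unfolding k_coloring_def by fastforce
    then have "\<rho> ` W = {1}" using W(1) by (simp add: subset_singleton_iff)
    then show False using W(3) unfolding monochromatic_def by simp
  qed
  ultimately show ?thesis by simp
qed

section \<open>The complete multipartite structure\<close>

text \<open>Otherwise \<open>u\<close>, \<open>v\<close>, \<open>w\<close> induce the edge
  \<open>u v\<close> plus the isolated vertex \<open>w\<close>. Read contrapositively, this is
  transitivity of non-adjacency.\<close>

lemma co_P3_freeD:
  assumes "co_P3_free G" "u \<rightarrow> v" "w \<in> verts G" "\<not> w \<rightarrow> u"
  shows "w \<rightarrow> v"
proof (rule ccontr)
  assume wv: "\<not> w \<rightarrow> v"
  have V: "{u, v, w} \<subseteq> verts G" using adj_in_verts[OF assms(2)] assms(3) by simp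
  have neq: "u \<noteq> v" "w \<noteq> u" "w \<noteq> v"
    using assms(2,4) wv adj_irrefl adj_sym by blast+
  define H where "H = G \<restriction> {u, v, w}"
  interpret H: graph H
    unfolding H_def using V by (rule graph_induce_subgraph)
  have "arcs_ends H = {(u, v), (v, u)}"
    unfolding H_def arcs_ends_induce_subgraph
    using assms(2,4) wv adj_irrefl adj_sym by blast
  \<comment> \<open>In the complement of the path 0, 1, 2 the only edge joins 0 and 2, so
    \<open>u\<close> and \<open>v\<close> go there and the isolated \<open>w\<close> goes to 1. Each
    arc is sent to the pair of images of its ends.\<close>
  moreover define f where "f x = (if x = u then 0 else if x = v then 2 else 1 :: nat)" for x
  define h where "h = \<lparr>iso_verts = f, iso_arcs = map_prod f f \<circ> arc_to_ends H,
    iso_head = snd, iso_tail = fst\<rparr>"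
  have f: "inj_on f (verts H)" "f ` verts H = {0, 1, 2}"
    using neq by (auto simp: H_def f_def inj_on_def)
  ultimately have arcs: "(map_prod f f \<circ> arc_to_ends H) ` arcs H = {(0, 2), (2, 0)}"
    using neq unfolding image_comp[symmetric] arcs_ends_def[symmetric] by (simp add: f_def)
  have "inj_on (map_prod f f) (arc_to_ends H ` arcs H)"
    by (rule inj_on_subset[OF map_prod_inj_on[OF f(1) f(1)]]) (auto simp: arc_to_ends_def)
  \<comment> \<open>Injectivity on arcs combines injectivity of \<open>f\<close> with the absence of
    parallel arcs in \<open>H\<close>.\<close>
  then have "inj_on (map_prod f f \<circ> arc_to_ends H) (arcs H)"
    using H.inj_on_arc_to_ends by (rule comp_inj_on[rotated])
  then have "H.digraph_isomorphism h"
    using f(1) H.wf_digraph by (simp add: H.digraph_isomorphism_def h_def arc_to_ends_def)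
  moreover have parcs: "parcs (complement path3) = {(0, 2), (2, 0)}"
    by (auto simp: complement_def path3_def)
  have "with_proj (complement path3) = app_iso h H"
    using f(2) arcs parcs by (simp add: with_proj_def app_iso_def complement_def path3_def h_def)
  ultimately show False
    using assms(1) V unfolding co_P3_free_def induced_free_def digraph_iso_def H_def by blast
qed

context
  assumes co_P3: "co_P3_free G"
begin

lemma nonneighbors_refl: "v \<in> verts G \<Longrightarrow> v \<in> nonneighbors G v"
  using adj_irrefl unfolding nonneighbors_def by blast

lemma nonneighbors_eq:
  assumes "v \<in> verts G" "w \<in> nonneighbors G v"
  shows "nonneighbors G w = nonneighbors G v"
  using assms co_P3_freeD[OF co_P3] adj_sym unfolding nonneighbors_def by blast

text \<open>The two sides are the parts of \<open>u\<close> and \<open>v\<close>: nothing is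
  adjacent within a part, everything is adjacent across. It serves as the larger biclique that a
  maximal one must equal.\<close>

lemma biclique_nonneighbors:
  assumes "u \<rightarrow> v"
  shows "biclique G (nonneighbors G u \<union> nonneighbors G v)"
proof -
  have uv: "u \<in> verts G" "v \<in> verts G" using adj_in_verts[OF assms] by auto
  define P Q where "P = nonneighbors G u" and "Q = nonneighbors G v"
  have P: "nonneighbors G x = P" if "x \<in> P" for x
    using that nonneighbors_eq[OF uv(1)] unfolding P_def by simp
  have Q: "nonneighbors G x = Q" if "x \<in> Q" for x
    using that nonneighbors_eq[OF uv(2)] unfolding Q_def by simp
  have adj: "x \<rightarrow> y \<longleftrightarrow> y \<notin> nonneighbors G x" if "y \<in> verts G" for x y
    using that unfolding nonneighbors_def by blast
  have sub: "P \<subseteq> verts G" "Q \<subseteq> verts G"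
    unfolding P_def Q_def nonneighbors_def by auto
  have mem: "u \<in> P" "v \<in> Q"
    unfolding P_def Q_def using uv nonneighbors_refl by auto
  have "v \<notin> P" unfolding P_def nonneighbors_def using assms by simp
  \<comment> \<open>A common element would make both parts equal to its own part, yet
    \<open>v\<close> lies only in \<open>Q\<close>.\<close>
  then have disj: "P \<inter> Q = {}" using P Q mem by blast
  have "x \<rightarrow> y \<longleftrightarrow> x \<in> P \<and> y \<in> Q \<or> x \<in> Q \<and> y \<in> P" if "x \<in> P \<union> Q" "y \<in> P \<union> Q" for x y
    using that adj[of y x] P[of x] Q[of x] sub disj by auto
  then have "arcs_ends G \<inter> (P \<union> Q) \<times> (P \<union> Q) = P \<times> Q \<union> Q \<times> P" by auto
  then show ?thesis
    unfolding biclique_iff P_def[symmetric] Q_def[symmetric]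
    using sub disj mem by (intro conjI exI[of _ P] exI[of _ Q]) auto
qed

lemma star_nonneighbors:
  assumes "u \<rightarrow> v"
  shows "star G (insert u (nonneighbors G v))"
proof -
  have uv: "u \<in> verts G" "v \<in> verts G" using adj_in_verts[OF assms] by auto
  have "u \<rightarrow> x" if "x \<in> nonneighbors G v" for x
    using that co_P3_freeD[OF co_P3, of v u x] adj_sym assms unfolding nonneighbors_def by blast
  moreover have "\<not> x \<rightarrow> y" if "x \<in> nonneighbors G v" "y \<in> nonneighbors G v" for x y
    using that nonneighbors_eq[OF uv(2)] unfolding nonneighbors_def by blast
  moreover have "nonneighbors G v \<subseteq> verts G" unfolding nonneighbors_def by auto
  moreover have "nonneighbors G v \<noteq> {}" using nonneighbors_refl[OF uv(2)] by auto
  ultimately show ?thesis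
    unfolding star_iff using uv by (intro conjI exI[of _ u] exI[of _ "nonneighbors G v"]) auto
qed

section \<open>Colorings from the parts\<close>

text \<open>Maximality forces whole parts into the set. If the set is monochromatic, such a part
  belongs to a universal vertex by \<open>parts\<close>, and two adjacent universal vertices of
  equal color contradict \<open>inj\<close>.\<close>

lemma coloring_of_nonneighbors:
  assumes inj: "inj_on \<rho> {v. universal_vertex G v}"
    and parts: "\<And>v. v \<in> verts G \<Longrightarrow> \<not> universal_vertex G v \<Longrightarrow>
      \<exists>x \<in> nonneighbors G v. \<exists>y \<in> nonneighbors G v. \<rho> x \<noteq> \<rho> y"
  shows "star_coloring G \<rho>" "biclique_coloring G \<rho>"
proof -
  have mono: "\<rho> x = \<rho> y" if "monochromatic \<rho> W" "x \<in> W" "y \<in> W" for W x y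
    using that unfolding monochromatic_def by (metis card_1_singletonE imageI singletonD)
  have universal: "universal_vertex G v"
    if "monochromatic \<rho> W" "nonneighbors G v \<subseteq> W" "v \<in> verts G" for W v
    using that(2,3) mono[OF that(1)] parts[of v] by blast
  have distinct: False if "monochromatic \<rho> W" "u \<rightarrow> v" "u \<in> W" "v \<in> W"
    "universal_vertex G u" "universal_vertex G v" for W u v
    using that mono[of W u v] inj adj_irrefl unfolding inj_on_def by blast
  show "star_coloring G \<rho>"
    unfolding star_coloring_def
  proof (safe)
    fix W assume W: "maximal_star G W" "monochromatic \<rho> W"
    then have "star G W" and max: "\<And>W'. star G W' \<Longrightarrow> W \<subseteq> W' \<Longrightarrow> W = W'"
      unfolding maximal_star_def by auto
    from this(1) obtain c V where sub: "W \<subseteq> verts G" and V: "V \<noteq> {}" "W = insert c V" "\<forall>v \<in> V. c \<rightarrow> v"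
      "\<forall>u \<in> V. \<forall>v \<in> V. \<not> u \<rightarrow> v"
      unfolding star_iff by blast
    then obtain v where v: "v \<in> V" "c \<rightarrow> v" by blast
    have "W \<subseteq> insert c (nonneighbors G v)"
      using sub V v unfolding nonneighbors_def by blast
    then have "W = insert c (nonneighbors G v)"
      using max[OF star_nonneighbors[OF v(2)]] by blast
    then have univ: "universal_vertex G v"
      using universal[OF W(2)] adj_in_verts[OF v(2)] by blast
    \<comment> \<open>The part of \<open>v\<close> is a singleton, so the star is a single edge.
      Center and leaf can now be exchanged, and the same argument makes \<open>c\<close>
      universal.\<close>
    then have "V = {v}" using V v sub unfolding universal_vertex_def by blast
    then have "W \<subseteq> insert v (nonneighbors G c)"
      using V nonneighbors_refl adj_in_verts[OF v(2)] by blast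
    then have "W = insert v (nonneighbors G c)"
      using max[OF star_nonneighbors[OF adj_sym[OF v(2)]]] by blast
    then have "universal_vertex G c"
      using universal[OF W(2)] adj_in_verts[OF v(2)] by blast
    then show False using distinct[OF W(2) v(2)] univ V v by blast
  qed
  show "biclique_coloring G \<rho>"
    unfolding biclique_coloring_def
  proof (safe)
    fix W assume W: "maximal_biclique G W" "monochromatic \<rho> W"
    then have "biclique G W" and max: "\<And>W'. biclique G W' \<Longrightarrow> W \<subseteq> W' \<Longrightarrow> W = W'"
      unfolding maximal_biclique_def by auto
    from this(1) obtain U V where sub: "W \<subseteq> verts G" and UV: "U \<noteq> {}" "V \<noteq> {}" "W = U \<union> V" "U \<inter> V = {}"
      "arcs_ends G \<inter> W \<times> W = U \<times> V \<union> V \<times> U"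
      unfolding biclique_iff by blast
    then obtain u v where uv: "u \<in> U" "v \<in> V" "u \<rightarrow> v" by blast
    have "W \<subseteq> nonneighbors G u \<union> nonneighbors G v"
      using sub UV uv unfolding nonneighbors_def by blast
    then have "W = nonneighbors G u \<union> nonneighbors G v"
      using max[OF biclique_nonneighbors[OF uv(3)]] by blast
    then have "universal_vertex G u" "universal_vertex G v"
      using universal[OF W(2)] adj_in_verts[OF uv(3)] by blast+
    then show False using distinct[OF W(2) uv(3)] UV uv by blast
  qed
qed

text \<open>Lists of size at least the number of universal vertices allow distinct colors on them.
  In every other part one representative keeps its color \<open>g\<close> and the remaining vertices
  avoid it, which lists of size at least 2 permit.\<close>

lemma ex_list_coloring:
  assumes "list_assignment c G L" "max 2 (card {v. universal_vertex G v}) \<le> c"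
  shows "\<exists>\<rho>. list_coloring G L \<rho> \<and> star_coloring G \<rho> \<and> biclique_coloring G \<rho>"
proof -
  have L: "finite (L v)" "card (L v) = c" if "v \<in> verts G" for v
    using assms(1) that unfolding list_assignment_def by auto
  obtain f where f: "inj_on f {v. universal_vertex G v}" "\<forall>v. universal_vertex G v \<longrightarrow> f v \<in> L v"
    using inj_on_choice_of_card_le[OF finite_universal, of L] L assms(2)
    unfolding universal_vertex_def by auto
  \<comment> \<open>The choice depends on \<open>v\<close> only through its set of nonneighbors, so
    all vertices of a part share one representative.\<close>
  define r where "r v = (SOME x. x \<in> nonneighbors G v)" for v
  define g where "g v = (SOME a. a \<in> L v)" for v
  define h where "h v = (SOME a. a \<in> L v - {g (r v)})" for v
  define \<rho> where "\<rho> v = (if universal_vertex G v then f v else if v = r v then g v else h v)" for v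
  have r: "r v \<in> nonneighbors G v" if "v \<in> verts G" for v
    unfolding r_def using nonneighbors_refl[OF that] by (rule someI)
  have g: "g v \<in> L v" if "v \<in> verts G" for v
  proof -
    have "L v \<noteq> {}" using L[OF that] assms(2) by force
    then show ?thesis unfolding g_def by (simp add: some_in_eq)
  qed
  have h: "h v \<in> L v - {g (r v)}" if "v \<in> verts G" for v
  proof -
    have "\<not> L v \<subseteq> {g (r v)}"
      using L[OF that] assms(2) card_mono[of "{g (r v)}" "L v"] by auto
    then have "L v - {g (r v)} \<noteq> {}" by blast
    then show ?thesis unfolding h_def by (subst some_in_eq)
  qed
  have "list_coloring G L \<rho>"
    using f(2) g h unfolding list_coloring_def \<rho>_def by auto
  moreover have "inj_on \<rho> {v. universal_vertex G v}"
    using f(1) by (simp add: inj_on_def \<rho>_def)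
  moreover have "\<exists>x \<in> nonneighbors G v. \<exists>y \<in> nonneighbors G v. \<rho> x \<noteq> \<rho> y"
    if v: "v \<in> verts G" "\<not> universal_vertex G v" for v
  proof -
    obtain w where w: "w \<in> nonneighbors G v" "w \<noteq> v"
      using v unfolding universal_vertex_def nonneighbors_def by blast
    \<comment> \<open>At least one of \<open>v\<close> and \<open>w\<close> differs from the
      representative.\<close>
    then obtain y where y: "y \<in> nonneighbors G v" "y \<noteq> r v"
      using nonneighbors_refl v(1) by metis
    have eq: "r x = r v" "x \<in> verts G" "\<not> universal_vertex G x" if "x \<in> nonneighbors G v" for x
    proof -
      show "r x = r v" unfolding r_def nonneighbors_eq[OF v(1) that] by simp
      show "x \<in> verts G" using that unfolding nonneighbors_def by blast
      show "\<not> universal_vertex G x"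
        using that v adj_sym unfolding universal_vertex_def nonneighbors_def by blast
    qed
    have "\<rho> (r v) = g (r v)" "\<rho> y = h y"
      using eq r[OF v(1)] y unfolding \<rho>_def by auto
    moreover have "h y \<noteq> g (r v)" using h[of y] eq y by auto
    ultimately show ?thesis using r[OF v(1)] y(1) by metis
  qed
  ultimately show ?thesis using coloring_of_nonneighbors by blast
qed

end

end

theorem theorem19:
  fixes G :: "('a, 'b) pre_digraph" and k :: nat
  assumes "graph G"
    and "co_P3_free G"
    and "card {v. universal_vertex G v} = k"
    and "arcs G \<noteq> {}"
  shows "ch_B G = chi_B G \<and> chi_B G = chi_S G \<and> chi_S G = ch_S G \<and> ch_S G = max 2 k"
proof -
  interpret graph G by fact
  let ?m = "max 2 k"
  note lower = max_2_card_universal_le[OF assms(4), unfolded assms(3)]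
  \<comment> \<open>Constant lists \<open>{1..c}\<close> make list colorings the same as
    \<open>c\<close>-colorings. The existence result for lists thus bounds \<open>chi_S\<close> and
    \<open>chi_B\<close> from above, and the lower bound for colorings carries over to
    choosability.\<close>
  have const: "list_assignment c G (\<lambda>_. {1..c})" for c
    by (simp add: list_assignment_def)
  have k_coloring_iff: "k_coloring c G \<rho> \<longleftrightarrow> list_coloring G (\<lambda>_. {1..c}) \<rho>" for c \<rho>
    by (simp add: k_coloring_def list_coloring_def)
  have choosable: "star_choosable ?m G" "biclique_choosable ?m G"
    using ex_list_coloring[OF assms(2)] assms(3)
    unfolding star_choosable_def biclique_choosable_def by blast+
  have "chi_S G = ?m" "chi_B G = ?m"
    unfolding chi_S_def chi_B_def
    using ex_list_coloring[OF assms(2) const[of ?m]] assms(3) lower k_coloring_iff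
    by (blast intro!: Least_equality)+
  moreover have "ch_S G = ?m"
    unfolding ch_S_def
  proof (rule Least_equality)
    show "?m \<le> c" if "star_choosable c G" for c
      using that const[of c] lower k_coloring_iff unfolding star_choosable_def by blast
  qed (rule choosable)
  moreover have "ch_B G = ?m"
    unfolding ch_B_def
  proof (rule Least_equality)
    show "?m \<le> c" if "biclique_choosable c G" for c
      using that const[of c] lower k_coloring_iff unfolding biclique_choosable_def by blast
  qed (rule choosable)
  ultimately show ?thesis by simp
qed

end
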